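(* Let $S$ be a left cancellative regular semigroup. Then $\ell^1(S)^{**}$ has an ultra central approximate identity if and only if $S$ is a group.
   Context: A semigroup $S$ is left cancellative if for all $a,b,c\in S$, $ca=cb$ implies $a=b$. It is regular if for every $s\in S$ there exists $s^*\in S$ with $s=ss^*s$ and $s^*=s^*ss^*$. $\ell^1(S)$ is the semigroup algebra with convolution product (determined by $\delta_s*\delta_t=\delta_{st}$). The second dual of a Banach algebra is a Banach algebra under the first Arens product. A Banach algebra $\mathcal{B}$ has an ultra central approximate identity if there is a (not necessarily bounded) net $(e_\alpha)$ in $\mathcal{B}^{**}$ such that $be_\alpha=e_\alpha b$ for all $\alpha$ and $e_\alpha b\to b$ in norm, for every $b\in\mathcal{B}$. (Here this is applied with $\mathcal{B}=\ell^1(S)^{**}$.) *)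

theory Defs
  imports "HOL-Analysis.Bounded_Linear_Function" "HOL-Analysis.Infinite_Sum"
begin

section \<open>Complex Banach algebras\<close>

class scaleC =
  fixes scaleC :: "complex \<Rightarrow> 'a \<Rightarrow> 'a" (infixr "*\<^sub>C" 75)

class complex_normed_vector = real_normed_vector + scaleC +
  assumes scaleC_add_right: "a *\<^sub>C (x + y) = a *\<^sub>C x + a *\<^sub>C y"
    and scaleC_add_left: "(a + b) *\<^sub>C x = a *\<^sub>C x + b *\<^sub>C x"
    and scaleC_scaleC: "a *\<^sub>C b *\<^sub>C x = (a * b) *\<^sub>C x"
    and scaleR_scaleC: "r *\<^sub>R x = complex_of_real r *\<^sub>C x"
    and norm_scaleC: "norm (a *\<^sub>C x) = cmod a * norm x"

class complex_normed_algebra = complex_normed_vector + real_normed_algebra +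
  assumes mult_scaleC_left: "(a *\<^sub>C x) * y = a *\<^sub>C (x * y)"
    and mult_scaleC_right: "x * (a *\<^sub>C y) = a *\<^sub>C (x * y)"

class complex_banach_algebra = complex_normed_algebra + banach

lemma scaleC_one [simp]: "1 *\<^sub>C x = (x :: 'a::complex_normed_vector)"
  using scaleR_scaleC[of 1 x] by simp

lemma scaleC_of_real: "complex_of_real r *\<^sub>C x = r *\<^sub>R (x :: 'a::complex_normed_vector)"
  by (simp add: scaleR_scaleC)

lemma scaleC_zero_right [simp]: "c *\<^sub>C (0 :: 'a::complex_normed_vector) = 0"
  using norm_scaleC[of c "0::'a"] by simp

section \<open>The dual space\<close>

text \<open>The bounded complex-linear functionals, with the operator norm.\<close>

typedef (overloaded) 'a cdual =
  "{f :: 'a::complex_normed_vector \<Rightarrow>\<^sub>L complex. \<forall>c x. blinfun_apply f (c *\<^sub>C x) = c * blinfun_apply f x}"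
  by (rule exI[of _ 0]) simp

setup_lifting type_definition_cdual

lift_definition cdual_apply :: "'a::complex_normed_vector cdual \<Rightarrow> 'a \<Rightarrow> complex" is blinfun_apply .

lemma cdual_eqI: "(\<And>x. cdual_apply f x = cdual_apply g x) \<Longrightarrow> f = g"
  by transfer (auto intro: blinfun_eqI)

instantiation cdual :: (complex_normed_vector) complex_normed_vector
begin

lift_definition zero_cdual :: "'a cdual" is 0 by simp
lift_definition plus_cdual :: "'a cdual \<Rightarrow> 'a cdual \<Rightarrow> 'a cdual" is "(+)"
  by (simp add: blinfun.bilinear_simps algebra_simps)
lift_definition minus_cdual :: "'a cdual \<Rightarrow> 'a cdual \<Rightarrow> 'a cdual" is "(-)"
  by (simp add: blinfun.bilinear_simps algebra_simps)
lift_definition uminus_cdual :: "'a cdual \<Rightarrow> 'a cdual" is uminus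
  by (simp add: blinfun.bilinear_simps)
lift_definition scaleR_cdual :: "real \<Rightarrow> 'a cdual \<Rightarrow> 'a cdual" is scaleR
  by (simp add: blinfun.bilinear_simps)
lift_definition norm_cdual :: "'a cdual \<Rightarrow> real" is norm .
lift_definition scaleC_cdual :: "complex \<Rightarrow> 'a cdual \<Rightarrow> 'a cdual"
  is "\<lambda>c f. blinfun_compose (blinfun_mult_right c) f"
  by simp

definition dist_cdual :: "'a cdual \<Rightarrow> 'a cdual \<Rightarrow> real"
  where "dist_cdual f g = norm (f - g)"
definition sgn_cdual :: "'a cdual \<Rightarrow> 'a cdual"
  where "sgn_cdual f = inverse (norm f) *\<^sub>R f"
definition [code del]:
  "(uniformity :: ('a cdual \<times> 'a cdual) filter) = (INF e\<in>{0<..}. principal {(x, y). dist x y < e})"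
definition open_cdual :: "'a cdual set \<Rightarrow> bool"
  where [code del]: "open_cdual S \<longleftrightarrow> (\<forall>x\<in>S. \<forall>\<^sub>F (x', y) in uniformity. x' = x \<longrightarrow> y \<in> S)"

lemma norm_blinfun_cmult:
  fixes f :: "'b::real_normed_vector \<Rightarrow>\<^sub>L complex"
  shows "norm (blinfun_compose (blinfun_mult_right c) f) = cmod c * norm f"
proof (cases "c = 0")
  case True
  then show ?thesis by (simp add: blinfun_eqI)
next
  case False
  have le: "norm (blinfun_compose (blinfun_mult_right c) f) \<le> cmod c * norm f" for c and f :: "'b \<Rightarrow>\<^sub>L complex"
  proof (rule norm_blinfun_bound)
    fix x
    show "norm ((blinfun_mult_right c o\<^sub>L f) x) \<le> cmod c * norm f * norm x"
      using mult_left_mono[OF norm_blinfun[of f x], of "cmod c"]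
      by (simp add: norm_mult mult.assoc)
  qed simp
  let ?g = "blinfun_compose (blinfun_mult_right c) f"
  have "blinfun_compose (blinfun_mult_right (inverse c)) ?g = f"
    using False by (intro blinfun_eqI) simp
  then have "norm f \<le> cmod (inverse c) * norm ?g"
    using le[of "inverse c" ?g] by simp
  then have "cmod c * norm f \<le> norm ?g"
    using False by (simp add: norm_divide inverse_eq_divide pos_le_divide_eq mult.commute)
  with le[of c f] show ?thesis by simp
qed

instance
proof
  fix f g h :: "'a cdual" and r s :: real and a b :: complex
  show "f + g + h = f + (g + h)" "f + g = g + f" "0 + f = f" "- f + f = 0" "f - g = f + - g"
    "r *\<^sub>R (f + g) = r *\<^sub>R f + r *\<^sub>R g" "(r + s) *\<^sub>R f = r *\<^sub>R f + s *\<^sub>R f"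
    "r *\<^sub>R s *\<^sub>R f = (r * s) *\<^sub>R f" "1 *\<^sub>R f = f"
    by (transfer, simp add: algebra_simps)+
  show "dist f g = norm (f - g)" "sgn f = inverse (norm f) *\<^sub>R f"
    by (simp_all add: dist_cdual_def sgn_cdual_def)
  show "(norm f = 0) = (f = 0)" "norm (f + g) \<le> norm f + norm g" "norm (r *\<^sub>R f) = \<bar>r\<bar> * norm f"
    by (transfer, simp add: norm_triangle_ineq)+
  show "a *\<^sub>C (f + g) = a *\<^sub>C f + a *\<^sub>C g" "(a + b) *\<^sub>C f = a *\<^sub>C f + b *\<^sub>C f"
    "a *\<^sub>C b *\<^sub>C f = (a * b) *\<^sub>C f" "r *\<^sub>R f = complex_of_real r *\<^sub>C f"
    by (transfer, rule blinfun_eqI, simp add: blinfun.bilinear_simps algebra_simps scaleR_conv_of_real)+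
  show "norm (a *\<^sub>C f) = cmod a * norm f"
    by transfer (rule norm_blinfun_cmult)
qed (simp_all add: uniformity_cdual_def open_cdual_def)

end

lemma cdual_apply_simps [simp]:
  "cdual_apply 0 x = 0"
  "cdual_apply (f + g) x = cdual_apply f x + cdual_apply g x"
  "cdual_apply (f - g) x = cdual_apply f x - cdual_apply g x"
  "cdual_apply (- f) x = - cdual_apply f x"
  "cdual_apply (r *\<^sub>R f) x = r *\<^sub>R cdual_apply f x"
  "cdual_apply (c *\<^sub>C f) x = c * cdual_apply f x"
  by (transfer, simp add: blinfun.bilinear_simps)+

lemma cdual_apply_linear [simp]:
  "cdual_apply f 0 = 0"
  "cdual_apply f (x + y) = cdual_apply f x + cdual_apply f y"
  "cdual_apply f (x - y) = cdual_apply f x - cdual_apply f y"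
  "cdual_apply f (- x) = - cdual_apply f x"
  "cdual_apply f (r *\<^sub>R x) = r *\<^sub>R cdual_apply f x"
  "cdual_apply f (c *\<^sub>C x) = c * cdual_apply f x"
  by (transfer, simp add: blinfun.bilinear_simps)+

lemma norm_cdual_apply: "cmod (cdual_apply f x) \<le> norm f * norm x"
  by transfer (rule norm_blinfun)

lemma norm_cdual_bound:
  "0 \<le> b \<Longrightarrow> (\<And>x. cmod (cdual_apply f x) \<le> b * norm x) \<Longrightarrow> norm f \<le> b"
  by transfer (rule norm_blinfun_bound)

lemma cdual_ex:
  fixes f :: "'a::complex_normed_vector \<Rightarrow> complex"
  assumes "\<And>x y. f (x + y) = f x + f y" "\<And>c x. f (c *\<^sub>C x) = c * f x"
    and "\<And>x. cmod (f x) \<le> norm x * K"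
  shows "\<exists>F. \<forall>x. cdual_apply F x = f x"
proof -
  have "bounded_linear f"
  proof (rule bounded_linear_intro)
    fix r x
    show "f (r *\<^sub>R x) = r *\<^sub>R f x"
      by (simp add: scaleR_scaleC assms(2) scaleR_conv_of_real)
  qed (use assms in auto)
  then have *: "blinfun_apply (Blinfun f) = f"
    by (rule bounded_linear_Blinfun_apply)
  then have "cdual_apply (Abs_cdual (Blinfun f)) = f"
    by (simp add: cdual_apply.rep_eq Abs_cdual_inverse assms(2))
  then show ?thesis by metis
qed

instance cdual :: (complex_normed_vector) banach
proof
  fix X :: "nat \<Rightarrow> 'a cdual"
  assume X: "Cauchy X"
  let ?Y = "\<lambda>n. Rep_cdual (X n)"
  have d: "dist (Rep_cdual f) (Rep_cdual g) = dist f g" for f g :: "'a cdual"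
    by (simp add: dist_norm norm_cdual.rep_eq minus_cdual.rep_eq)
  from X have "Cauchy ?Y"
    by (simp add: Cauchy_def d)
  then obtain L where L: "?Y \<longlonglongrightarrow> L"
    by (auto simp: Cauchy_convergent_iff convergent_def)
  have app: "(\<lambda>n. blinfun_apply (?Y n) x) \<longlonglongrightarrow> blinfun_apply L x" for x
    using L by (intro blinfun.tendsto tendsto_const)
  have "blinfun_apply L (c *\<^sub>C x) = c * blinfun_apply L x" for c x
  proof (rule LIMSEQ_unique[OF app])
    have "blinfun_apply (?Y n) (c *\<^sub>C x) = c * blinfun_apply (?Y n) x" for n
      using Rep_cdual by blast
    then show "(\<lambda>n. blinfun_apply (?Y n) (c *\<^sub>C x)) \<longlonglongrightarrow> c * blinfun_apply L x"
      using app[of x] by (simp add: tendsto_mult_left)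
  qed
  then have "L = Rep_cdual (Abs_cdual L)"
    by (simp add: Abs_cdual_inverse)
  with L have "(\<lambda>n. Rep_cdual (X n)) \<longlonglongrightarrow> Rep_cdual (Abs_cdual L)"
    by metis
  then have "X \<longlonglongrightarrow> Abs_cdual L"
    by (simp add: lim_sequentially d)
  then show "convergent X"
    by (auto simp: convergent_def)
qed

section \<open>The second dual with the first Arens product\<close>

typedef (overloaded) 'a bidual = "UNIV :: 'a::complex_normed_vector cdual cdual set" ..

lifting_forget cdual.lifting
setup_lifting type_definition_bidual

lift_definition bidual_apply :: "'a::complex_normed_vector bidual \<Rightarrow> 'a cdual \<Rightarrow> complex" is cdual_apply .

lemma bidual_eqI: "(\<And>f. bidual_apply F f = bidual_apply G f) \<Longrightarrow> F = G"
  by transfer (rule cdual_eqI)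

instantiation bidual :: (complex_normed_vector) complex_normed_vector
begin

lift_definition zero_bidual :: "'a bidual" is 0 .
lift_definition plus_bidual :: "'a bidual \<Rightarrow> 'a bidual \<Rightarrow> 'a bidual" is "(+)" .
lift_definition minus_bidual :: "'a bidual \<Rightarrow> 'a bidual \<Rightarrow> 'a bidual" is "(-)" .
lift_definition uminus_bidual :: "'a bidual \<Rightarrow> 'a bidual" is uminus .
lift_definition scaleR_bidual :: "real \<Rightarrow> 'a bidual \<Rightarrow> 'a bidual" is scaleR .
lift_definition scaleC_bidual :: "complex \<Rightarrow> 'a bidual \<Rightarrow> 'a bidual" is scaleC .
lift_definition norm_bidual :: "'a bidual \<Rightarrow> real" is norm .

definition dist_bidual :: "'a bidual \<Rightarrow> 'a bidual \<Rightarrow> real"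
  where "dist_bidual F G = norm (F - G)"
definition sgn_bidual :: "'a bidual \<Rightarrow> 'a bidual"
  where "sgn_bidual F = inverse (norm F) *\<^sub>R F"
definition [code del]:
  "(uniformity :: ('a bidual \<times> 'a bidual) filter) = (INF e\<in>{0<..}. principal {(x, y). dist x y < e})"
definition open_bidual :: "'a bidual set \<Rightarrow> bool"
  where [code del]: "open_bidual S \<longleftrightarrow> (\<forall>x\<in>S. \<forall>\<^sub>F (x', y) in uniformity. x' = x \<longrightarrow> y \<in> S)"

instance
proof
  fix f g h :: "'a bidual" and r s :: real and a b :: complex
  show "f + g + h = f + (g + h)" "f + g = g + f" "0 + f = f" "- f + f = 0" "f - g = f + - g"
    "r *\<^sub>R (f + g) = r *\<^sub>R f + r *\<^sub>R g" "(r + s) *\<^sub>R f = r *\<^sub>R f + s *\<^sub>R f"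
    "r *\<^sub>R s *\<^sub>R f = (r * s) *\<^sub>R f" "1 *\<^sub>R f = f"
    by (transfer, simp add: algebra_simps)+
  show "dist f g = norm (f - g)" "sgn f = inverse (norm f) *\<^sub>R f"
    by (simp_all add: dist_bidual_def sgn_bidual_def)
  show "(norm f = 0) = (f = 0)" "norm (f + g) \<le> norm f + norm g" "norm (r *\<^sub>R f) = \<bar>r\<bar> * norm f"
    by (transfer, simp add: norm_triangle_ineq)+
  show "a *\<^sub>C (f + g) = a *\<^sub>C f + a *\<^sub>C g" "(a + b) *\<^sub>C f = a *\<^sub>C f + b *\<^sub>C f"
    "a *\<^sub>C b *\<^sub>C f = (a * b) *\<^sub>C f" "r *\<^sub>R f = complex_of_real r *\<^sub>C f"
    "norm (a *\<^sub>C f) = cmod a * norm f"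
    by (transfer, simp add: scaleC_add_left scaleC_add_right scaleC_scaleC scaleR_scaleC norm_scaleC)+
qed (simp_all add: uniformity_bidual_def open_bidual_def)

end

instance bidual :: (complex_normed_vector) banach
proof
  fix X :: "nat \<Rightarrow> 'a bidual"
  assume X: "Cauchy X"
  have d: "dist (Rep_bidual f) (Rep_bidual g) = dist f g" for f g :: "'a bidual"
    by (simp add: dist_norm norm_bidual.rep_eq minus_bidual.rep_eq)
  from X have "Cauchy (\<lambda>n. Rep_bidual (X n))"
    by (simp add: Cauchy_def d)
  then obtain L where L: "(\<lambda>n. Rep_bidual (X n)) \<longlonglongrightarrow> L"
    by (auto simp: Cauchy_convergent_iff convergent_def)
  have "L = Rep_bidual (Abs_bidual L)"
    by (simp add: Abs_bidual_inverse)
  with L have "(\<lambda>n. Rep_bidual (X n)) \<longlonglongrightarrow> Rep_bidual (Abs_bidual L)"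
    by metis
  then have "X \<longlonglongrightarrow> Abs_bidual L"
    by (simp add: lim_sequentially d)
  then show "convergent X"
    by (auto simp: convergent_def)
qed

lemma bidual_apply_simps [simp]:
  "bidual_apply 0 x = 0"
  "bidual_apply (f + g) x = bidual_apply f x + bidual_apply g x"
  "bidual_apply (f - g) x = bidual_apply f x - bidual_apply g x"
  "bidual_apply (- f) x = - bidual_apply f x"
  "bidual_apply (r *\<^sub>R f) x = r *\<^sub>R bidual_apply f x"
  "bidual_apply (c *\<^sub>C f) x = c * bidual_apply f x"
  by (transfer, simp)+

lemma bidual_apply_linear [simp]:
  "bidual_apply f 0 = 0"
  "bidual_apply f (x + y) = bidual_apply f x + bidual_apply f y"
  "bidual_apply f (x - y) = bidual_apply f x - bidual_apply f y"
  "bidual_apply f (- x) = - bidual_apply f x"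
  "bidual_apply f (r *\<^sub>R x) = r *\<^sub>R bidual_apply f x"
  "bidual_apply f (c *\<^sub>C x) = c * bidual_apply f x"
  by (transfer, simp)+

lemma norm_bidual_apply: "cmod (bidual_apply F f) \<le> norm F * norm f"
  by transfer (rule norm_cdual_apply)

lemma norm_bidual_bound:
  "0 \<le> b \<Longrightarrow> (\<And>f. cmod (bidual_apply F f) \<le> b * norm f) \<Longrightarrow> norm F \<le> b"
  by transfer (rule norm_cdual_bound)

lemma bidual_ex:
  fixes f :: "'a::complex_normed_vector cdual \<Rightarrow> complex"
  assumes "\<And>x y. f (x + y) = f x + f y" "\<And>c x. f (c *\<^sub>C x) = c * f x"
    and "\<And>x. cmod (f x) \<le> norm x * K"
  shows "\<exists>F. \<forall>x. bidual_apply F x = f x"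
  using cdual_ex[of f K, OF assms]
  by (metis (no_types, lifting) Abs_bidual_inverse UNIV_I bidual_apply.rep_eq)

definition bidual_embed :: "'a::complex_normed_vector \<Rightarrow> 'a bidual"
  where "bidual_embed a = (THE F. \<forall>f. bidual_apply F f = cdual_apply f a)"

lemma bidual_embed_apply [simp]: "bidual_apply (bidual_embed a) f = cdual_apply f a"
proof -
  have "\<exists>F. \<forall>f. bidual_apply F f = cdual_apply f a"
    by (rule bidual_ex[where K = "norm a"]) (simp_all add: norm_cdual_apply)
  then have "\<exists>!F. \<forall>f. bidual_apply F f = cdual_apply f a"
    by (metis bidual_eqI)
  from theI'[OF this] show ?thesis
    unfolding bidual_embed_def by blast
qed

text \<open>
  The first Arens product is built in three steps: \<open>(f \<cdot> a)(b) = f (a b)\<close>,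
  then \<open>(G \<cdot> f)(a) = G (f \<cdot> a)\<close>, and finally \<open>(F G)(f) = F (G \<cdot> f)\<close>,
  for \<open>a\<close>, \<open>b\<close> in the algebra, \<open>f\<close> in the dual, and \<open>F\<close>, \<open>G\<close> in the second dual.
\<close>

definition cdual_act :: "'a::complex_normed_algebra cdual \<Rightarrow> 'a \<Rightarrow> 'a cdual"
  where "cdual_act f a = (THE g. \<forall>b. cdual_apply g b = cdual_apply f (a * b))"

definition bidual_act :: "'a::complex_normed_algebra bidual \<Rightarrow> 'a cdual \<Rightarrow> 'a cdual"
  where "bidual_act G f = (THE g. \<forall>a. cdual_apply g a = bidual_apply G (cdual_act f a))"

definition arens :: "'a::complex_normed_algebra bidual \<Rightarrow> 'a bidual \<Rightarrow> 'a bidual"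
  where "arens F G = (THE H. \<forall>f. bidual_apply H f = bidual_apply F (bidual_act G f))"

lemma cdual_act_apply [simp]: "cdual_apply (cdual_act f a) b = cdual_apply f (a * b)"
proof -
  have "\<exists>g. \<forall>b. cdual_apply g b = cdual_apply f (a * b)"
  proof (rule cdual_ex[where K = "norm f * norm a"])
    fix b
    show "cmod (cdual_apply f (a * b)) \<le> norm b * (norm f * norm a)"
      using order_trans[OF norm_cdual_apply mult_left_mono[OF norm_mult_ineq, of "norm f" a b]]
      by (simp add: mult_ac)
  qed (simp_all add: distrib_left mult_scaleC_right)
  then have "\<exists>!g. \<forall>b. cdual_apply g b = cdual_apply f (a * b)"
    by (metis cdual_eqI)
  from theI'[OF this] show ?thesis
    unfolding cdual_act_def by blast
qed

lemma norm_cdual_act: "norm (cdual_act f a) \<le> norm f * norm a"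
proof (rule norm_cdual_bound)
  fix b
  show "cmod (cdual_apply (cdual_act f a) b) \<le> norm f * norm a * norm b"
    using order_trans[OF norm_cdual_apply mult_left_mono[OF norm_mult_ineq, of "norm f" a b]]
    by (simp add: mult_ac)
qed simp

lemma cdual_act_linear:
  "cdual_act f (a + b) = cdual_act f a + cdual_act f b"
  "cdual_act f (c *\<^sub>C a) = c *\<^sub>C cdual_act f a"
  "cdual_act (f + g) a = cdual_act f a + cdual_act g a"
  "cdual_act (c *\<^sub>C f) a = c *\<^sub>C cdual_act f a"
  by (rule cdual_eqI, simp add: distrib_right mult_scaleC_left)+

lemma bidual_act_apply [simp]: "cdual_apply (bidual_act G f) a = bidual_apply G (cdual_act f a)"
proof -
  have "\<exists>g. \<forall>a. cdual_apply g a = bidual_apply G (cdual_act f a)"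
  proof (rule cdual_ex[where K = "norm G * norm f"])
    fix a
    show "cmod (bidual_apply G (cdual_act f a)) \<le> norm a * (norm G * norm f)"
      using order_trans[OF norm_bidual_apply mult_left_mono[OF norm_cdual_act, of "norm G" f a]]
      by (simp add: mult_ac)
  qed (simp_all add: cdual_act_linear)
  then have "\<exists>!g. \<forall>a. cdual_apply g a = bidual_apply G (cdual_act f a)"
    by (metis cdual_eqI)
  from theI'[OF this] show ?thesis
    unfolding bidual_act_def by blast
qed

lemma norm_bidual_act: "norm (bidual_act G f) \<le> norm G * norm f"
proof (rule norm_cdual_bound)
  fix a
  show "cmod (cdual_apply (bidual_act G f) a) \<le> norm G * norm f * norm a"
    using order_trans[OF norm_bidual_apply mult_left_mono[OF norm_cdual_act, of "norm G" f a]]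
    by (simp add: mult_ac)
qed simp

lemma bidual_act_linear:
  "bidual_act G (f + g) = bidual_act G f + bidual_act G g"
  "bidual_act G (c *\<^sub>C f) = c *\<^sub>C bidual_act G f"
  "bidual_act (G + H) f = bidual_act G f + bidual_act H f"
  "bidual_act (c *\<^sub>C G) f = c *\<^sub>C bidual_act G f"
  by (rule cdual_eqI, simp add: cdual_act_linear)+

lemma arens_apply [simp]: "bidual_apply (arens F G) f = bidual_apply F (bidual_act G f)"
proof -
  have "\<exists>H. \<forall>f. bidual_apply H f = bidual_apply F (bidual_act G f)"
  proof (rule bidual_ex[where K = "norm F * norm G"])
    fix f
    show "cmod (bidual_apply F (bidual_act G f)) \<le> norm f * (norm F * norm G)"
      using order_trans[OF norm_bidual_apply mult_left_mono[OF norm_bidual_act, of "norm F" G f]]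
      by (simp add: mult_ac)
  qed (simp_all add: bidual_act_linear)
  then have "\<exists>!H. \<forall>f. bidual_apply H f = bidual_apply F (bidual_act G f)"
    by (metis bidual_eqI)
  from theI'[OF this] show ?thesis
    unfolding arens_def by blast
qed

instantiation bidual :: (complex_normed_algebra) complex_banach_algebra
begin

definition times_bidual :: "'a bidual \<Rightarrow> 'a bidual \<Rightarrow> 'a bidual"
  where "times_bidual = arens"

instance
proof
  fix F G H :: "'a bidual" and r :: real and c :: complex
  have act: "cdual_act (cdual_act f a) b = cdual_act f (a * b)" for f :: "'a cdual" and a b
    by (rule cdual_eqI) (simp add: mult.assoc)
  have act2: "bidual_act G (cdual_act f a) = cdual_act (bidual_act G f) a" for f :: "'a cdual" and a
    by (rule cdual_eqI) (simp add: act)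
  have "bidual_act (arens F G) f = bidual_act F (bidual_act G f)" for F G :: "'a bidual" and f
    by (rule cdual_eqI, simp) (metis act bidual_act_apply cdual_act_apply cdual_eqI)
  then show "F * G * H = F * (G * H)"
    unfolding times_bidual_def by (intro bidual_eqI) simp
  show "(F + G) * H = F * H + G * H" "F * (G + H) = F * G + F * H"
    "(c *\<^sub>C F) * G = c *\<^sub>C (F * G)" "F * (c *\<^sub>C G) = c *\<^sub>C (F * G)"
    "(r *\<^sub>R F) * G = r *\<^sub>R (F * G)" "F * (r *\<^sub>R G) = r *\<^sub>R (F * G)"
    unfolding times_bidual_def scaleR_scaleC
    by (rule bidual_eqI, simp add: bidual_act_linear)+
  show "norm (F * G) \<le> norm F * norm G"
    unfolding times_bidual_def
  proof (rule norm_bidual_bound)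
    fix f
    show "cmod (bidual_apply (arens F G) f) \<le> norm F * norm G * norm f"
      using order_trans[OF norm_bidual_apply mult_left_mono[OF norm_bidual_act, of "norm F" G f]]
      by (simp add: mult_ac)
  qed simp
qed

end

section \<open>Ultra central approximate identities\<close>

text \<open>A net is a family indexed by a nonempty set \<open>I\<close> carrying a directed preorder \<open>le\<close>.\<close>

definition directed_set :: "'i set \<Rightarrow> ('i \<Rightarrow> 'i \<Rightarrow> bool) \<Rightarrow> bool"
  where "directed_set I le \<longleftrightarrow> I \<noteq> {} \<and> (\<forall>i\<in>I. le i i) \<and>
    (\<forall>i\<in>I. \<forall>j\<in>I. \<forall>k\<in>I. le i j \<longrightarrow> le j k \<longrightarrow> le i k) \<and>
    (\<forall>i\<in>I. \<forall>j\<in>I. \<exists>k\<in>I. le i k \<and> le j k)"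

definition tails :: "'i set \<Rightarrow> ('i \<Rightarrow> 'i \<Rightarrow> bool) \<Rightarrow> 'i filter"
  where "tails I le = (INF i\<in>I. principal {j\<in>I. le i j})"

lemma eventually_tails:
  assumes "directed_set I le"
  shows "eventually P (tails I le) \<longleftrightarrow> (\<exists>i\<in>I. \<forall>j\<in>I. le i j \<longrightarrow> P j)"
proof -
  have "eventually P (tails I le) \<longleftrightarrow> (\<exists>i\<in>I. eventually P (principal {j\<in>I. le i j}))"
    unfolding tails_def
  proof (rule eventually_INF_base)
    show "I \<noteq> {}"
      using assms by (simp add: directed_set_def)
    fix i j
    assume ij: "i \<in> I" "j \<in> I"
    with assms obtain k where k: "k \<in> I" "le i k" "le j k"
      unfolding directed_set_def by metis
    have trans: "le a l" if "a \<in> I" "le a k" "l \<in> I" "le k l" for a l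
      using assms k(1) that unfolding directed_set_def by blast
    have "{l \<in> I. le k l} \<subseteq> {l \<in> I. le i l} \<inter> {l \<in> I. le j l}"
      using trans ij k by blast
    then show "\<exists>k\<in>I. principal {l \<in> I. le k l} \<le> inf (principal {l \<in> I. le i l}) (principal {l \<in> I. le j l})"
      using k(1) by (intro bexI[of _ k]) simp_all
  qed
  then show ?thesis
    by (auto simp: eventually_principal)
qed

definition ultra_central_approximate_identity ::
    "'i set \<Rightarrow> ('i \<Rightarrow> 'i \<Rightarrow> bool) \<Rightarrow> ('i \<Rightarrow> 'b::complex_banach_algebra bidual) \<Rightarrow> bool"
  where "ultra_central_approximate_identity I le e \<longleftrightarrow> directed_set I le \<and>
    (\<forall>b. \<forall>i\<in>I. bidual_embed b * e i = e i * bidual_embed b) \<and>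
    (\<forall>b. ((\<lambda>i. e i * bidual_embed b) \<longlongrightarrow> bidual_embed b) (tails I le))"

text \<open>
  Existence of a net cannot be quantified over all index types, so a sufficiently large index
  type is fixed here; the lemma below shows that this is no restriction.
\<close>

definition has_ultra_central_approximate_identity :: "'b::complex_banach_algebra itself \<Rightarrow> bool"
  where "has_ultra_central_approximate_identity _ \<longleftrightarrow>
    (\<exists>(I :: ('b set \<times> nat) set) le (e :: 'b set \<times> nat \<Rightarrow> 'b bidual).
      ultra_central_approximate_identity I le e)"

lemma has_ultra_central_approximate_identityI:
  fixes I :: "'i set" and e :: "'i \<Rightarrow> 'b::complex_banach_algebra bidual"
  assumes "ultra_central_approximate_identity I le e"
  shows "has_ultra_central_approximate_identity TYPE('b)"
proof -
  have dir: "directed_set I le"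
    and comm: "\<And>b i. i \<in> I \<Longrightarrow> bidual_embed b * e i = e i * bidual_embed b"
    and lim: "\<And>b. ((\<lambda>i. e i * bidual_embed b) \<longlongrightarrow> bidual_embed b) (tails I le)"
    using assms by (auto simp: ultra_central_approximate_identity_def)
  have "\<exists>i\<in>I. \<forall>b\<in>A. dist (e i * bidual_embed b) (bidual_embed b) < 1 / real (Suc n)"
    if "finite A" for A n
  proof -
    have "\<forall>b\<in>A. \<forall>\<^sub>F i in tails I le. dist (e i * bidual_embed b) (bidual_embed b) < 1 / real (Suc n)"
      using lim by (intro ballI tendstoD) auto
    then have "\<forall>\<^sub>F i in tails I le. \<forall>b\<in>A. dist (e i * bidual_embed b) (bidual_embed b) < 1 / real (Suc n)"
      by (rule eventually_ball_finite[OF that])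
    then show ?thesis
      using dir unfolding eventually_tails[OF dir] directed_set_def by metis
  qed
  then have "\<exists>\<phi>. \<forall>A n. finite A \<longrightarrow> \<phi> A n \<in> I \<and>
      (\<forall>b\<in>A. dist (e (\<phi> A n) * bidual_embed b) (bidual_embed b) < 1 / real (Suc n))"
    by metis
  then obtain \<phi> where \<phi>: "\<And>A n. finite A \<Longrightarrow> \<phi> A n \<in> I"
    "\<And>A n b. finite A \<Longrightarrow> b \<in> A \<Longrightarrow>
      dist (e (\<phi> A n) * bidual_embed b) (bidual_embed b) < 1 / real (Suc n)"
    by metis
  let ?J = "{p :: 'b set \<times> nat. finite (fst p)}"
  let ?le = "\<lambda>p q :: 'b set \<times> nat. fst p \<subseteq> fst q \<and> snd p \<le> snd q"
  let ?e = "\<lambda>p. e (\<phi> (fst p) (snd p))"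
  have dir': "directed_set ?J ?le"
    unfolding directed_set_def
  proof (intro conjI ballI impI)
    fix p q
    assume "p \<in> ?J" "q \<in> ?J"
    then show "\<exists>k\<in>?J. ?le p k \<and> ?le q k"
      by (intro bexI[of _ "(fst p \<union> fst q, max (snd p) (snd q))"]) auto
  qed auto
  have "((\<lambda>p. ?e p * bidual_embed b) \<longlongrightarrow> bidual_embed b) (tails ?J ?le)" for b
  proof (rule tendstoI)
    fix \<epsilon> :: real
    assume "\<epsilon> > 0"
    then obtain n where n: "1 / real (Suc n) < \<epsilon>"
      using nat_approx_posE by blast
    have "dist (?e p * bidual_embed b) (bidual_embed b) < \<epsilon>"
      if "p \<in> ?J" "?le ({b}, n) p" for p
    proof -
      have "dist (?e p * bidual_embed b) (bidual_embed b) < 1 / real (Suc (snd p))"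
        using that by (intro \<phi>) auto
      also have "\<dots> \<le> 1 / real (Suc n)"
        using that by (simp add: frac_le)
      finally show ?thesis using n by simp
    qed
    then show "\<forall>\<^sub>F p in tails ?J ?le. dist (?e p * bidual_embed b) (bidual_embed b) < \<epsilon>"
      unfolding eventually_tails[OF dir'] by (intro bexI[of _ "({b}, n)"]) auto
  qed
  with dir' have "ultra_central_approximate_identity ?J ?le ?e"
    unfolding ultra_central_approximate_identity_def by (auto intro!: comm \<phi>)
  then show ?thesis
    unfolding has_ultra_central_approximate_identity_def by blast
qed

section \<open>The semigroup algebra\<close>

typedef 'a ell1 = "{f :: 'a \<Rightarrow> complex. f abs_summable_on UNIV}"
  by (rule exI[of _ "\<lambda>_. 0"]) simp

setup_lifting type_definition_ell1

lift_definition ell1_apply :: "'a ell1 \<Rightarrow> 'a \<Rightarrow> complex" is "\<lambda>f. f" .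

lemma ell1_eqI: "(\<And>x. ell1_apply f x = ell1_apply g x) \<Longrightarrow> f = g"
  by transfer auto

lemma ell1_summable: "(\<lambda>x. norm (ell1_apply f x)) summable_on UNIV"
  by transfer simp

lemma abs_summable_add:
  fixes f g :: "'a \<Rightarrow> 'b::real_normed_vector"
  assumes "f abs_summable_on A" "g abs_summable_on A"
  shows "(\<lambda>x. f x + g x) abs_summable_on A"
  by (rule abs_summable_on_comparison_test'[OF summable_on_add[OF assms]]) (rule norm_triangle_ineq)

lemma abs_summable_cmult:
  fixes f :: "'a \<Rightarrow> complex"
  assumes "f abs_summable_on A"
  shows "(\<lambda>x. c * f x) abs_summable_on A"
  unfolding norm_mult by (rule summable_on_cmult_right[OF assms])

instantiation ell1 :: (type) complex_normed_vector
begin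

lift_definition zero_ell1 :: "'a ell1" is "\<lambda>_. 0" by simp
lift_definition plus_ell1 :: "'a ell1 \<Rightarrow> 'a ell1 \<Rightarrow> 'a ell1" is "\<lambda>f g x. f x + g x"
  by (rule abs_summable_add)
lift_definition minus_ell1 :: "'a ell1 \<Rightarrow> 'a ell1 \<Rightarrow> 'a ell1" is "\<lambda>f g x. f x - g x"
  unfolding diff_conv_add_uminus by (intro abs_summable_add) simp_all
lift_definition uminus_ell1 :: "'a ell1 \<Rightarrow> 'a ell1" is "\<lambda>f x. - f x"
  by simp
lift_definition scaleC_ell1 :: "complex \<Rightarrow> 'a ell1 \<Rightarrow> 'a ell1" is "\<lambda>c f x. c * f x"
  by (rule abs_summable_cmult)
lift_definition norm_ell1 :: "'a ell1 \<Rightarrow> real" is "\<lambda>f. \<Sum>\<^sub>\<infinity>x. norm (f x)" .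

definition scaleR_ell1 :: "real \<Rightarrow> 'a ell1 \<Rightarrow> 'a ell1"
  where "scaleR_ell1 r f = complex_of_real r *\<^sub>C f"
definition dist_ell1 :: "'a ell1 \<Rightarrow> 'a ell1 \<Rightarrow> real"
  where "dist_ell1 f g = norm (f - g)"
definition sgn_ell1 :: "'a ell1 \<Rightarrow> 'a ell1"
  where "sgn_ell1 f = inverse (norm f) *\<^sub>R f"
definition [code del]:
  "(uniformity :: ('a ell1 \<times> 'a ell1) filter) = (INF e\<in>{0<..}. principal {(x, y). dist x y < e})"
definition open_ell1 :: "'a ell1 set \<Rightarrow> bool"
  where [code del]: "open_ell1 S \<longleftrightarrow> (\<forall>x\<in>S. \<forall>\<^sub>F (x', y) in uniformity. x' = x \<longrightarrow> y \<in> S)"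

instance
proof
  fix f g h :: "'a ell1" and r s :: real and a b :: complex
  show "f + g + h = f + (g + h)" "f + g = g + f" "0 + f = f" "- f + f = 0" "f - g = f + - g"
    by (transfer, simp add: algebra_simps)+
  show "r *\<^sub>R (f + g) = r *\<^sub>R f + r *\<^sub>R g" "(r + s) *\<^sub>R f = r *\<^sub>R f + s *\<^sub>R f"
    "r *\<^sub>R s *\<^sub>R f = (r * s) *\<^sub>R f" "1 *\<^sub>R f = f"
    unfolding scaleR_ell1_def by (transfer, simp add: algebra_simps)+
  show "dist f g = norm (f - g)" "sgn f = inverse (norm f) *\<^sub>R f" "r *\<^sub>R f = complex_of_real r *\<^sub>C f"
    by (simp_all add: dist_ell1_def sgn_ell1_def scaleR_ell1_def)
  show "(norm f = 0) = (f = 0)"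
  proof transfer
    fix f :: "'a \<Rightarrow> complex"
    assume f: "f abs_summable_on UNIV"
    show "((\<Sum>\<^sub>\<infinity>x. norm (f x)) = 0) = (f = (\<lambda>_. 0))"
    proof
      assume 0: "(\<Sum>\<^sub>\<infinity>x. norm (f x)) = 0"
      have "norm (f x) = 0" for x
        by (rule nonneg_infsum_le_0D[where A = UNIV]) (use 0 f in simp_all)
      then show "f = (\<lambda>_. 0)" by auto
    qed simp
  qed
  show "norm (f + g) \<le> norm f + norm g"
  proof transfer
    fix f g :: "'a \<Rightarrow> complex"
    assume fg: "f abs_summable_on UNIV" "g abs_summable_on UNIV"
    have "(\<Sum>\<^sub>\<infinity>x. norm (f x + g x)) \<le> (\<Sum>\<^sub>\<infinity>x. norm (f x) + norm (g x))"
      by (rule infsum_mono) (auto intro: abs_summable_add summable_on_add fg norm_triangle_ineq)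
    also have "\<dots> = (\<Sum>\<^sub>\<infinity>x. norm (f x)) + (\<Sum>\<^sub>\<infinity>x. norm (g x))"
      by (rule infsum_add[OF fg])
    finally show "(\<Sum>\<^sub>\<infinity>x. norm (f x + g x)) \<le> (\<Sum>\<^sub>\<infinity>x. norm (f x)) + (\<Sum>\<^sub>\<infinity>x. norm (g x))" .
  qed
  have n: "norm (c *\<^sub>C f) = cmod c * norm f" for c
    by transfer (simp add: norm_mult infsum_cmult_right')
  then show "norm (a *\<^sub>C f) = cmod a * norm f" .
  show "norm (r *\<^sub>R f) = \<bar>r\<bar> * norm f"
    unfolding scaleR_ell1_def by (simp add: n)
  show "a *\<^sub>C (f + g) = a *\<^sub>C f + a *\<^sub>C g" "(a + b) *\<^sub>C f = a *\<^sub>C f + b *\<^sub>C f"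
    "a *\<^sub>C b *\<^sub>C f = (a * b) *\<^sub>C f"
    by (transfer, simp add: algebra_simps)+
qed (simp_all add: uniformity_ell1_def open_ell1_def)

end

lemma sum_le_norm_ell1: "finite A \<Longrightarrow> (\<Sum>x\<in>A. norm (ell1_apply f x)) \<le> norm f"
  by transfer (auto intro!: finite_sum_le_infsum)

instance ell1 :: (type) banach
proof
  fix X :: "nat \<Rightarrow> 'a ell1"
  assume X: "Cauchy X"
  have diff: "ell1_apply (f - g) x = ell1_apply f x - ell1_apply g x" for f g :: "'a ell1" and x
    by transfer simp
  have le: "norm (ell1_apply f x - ell1_apply g x) \<le> norm (f - g)" for f g :: "'a ell1" and x
    using sum_le_norm_ell1[of "{x}" "f - g"] by (simp add: diff)
  have "Cauchy (\<lambda>n. ell1_apply (X n) x)" for x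
  proof (rule CauchyI)
    fix e :: real
    assume "e > 0"
    with X obtain M where "\<forall>m\<ge>M. \<forall>n\<ge>M. norm (X m - X n) < e"
      by (meson CauchyD)
    then show "\<exists>M. \<forall>m\<ge>M. \<forall>n\<ge>M. norm (ell1_apply (X m) x - ell1_apply (X n) x) < e"
      using le order_le_less_trans by blast
  qed
  then have "\<exists>l. (\<lambda>n. ell1_apply (X n) x) \<longlonglongrightarrow> l" for x
    by (simp add: Cauchy_convergent_iff convergent_def)
  then obtain L where L: "\<And>x. (\<lambda>n. ell1_apply (X n) x) \<longlonglongrightarrow> L x"
    by metis
  have fin: "(\<Sum>x\<in>A. norm (ell1_apply (X n) x - L x)) \<le> e"
    if "finite A" "\<forall>m\<ge>M. \<forall>n\<ge>M. norm (X m - X n) < e" "n \<ge> M" for A M n e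
  proof (rule tendsto_upperbound)
    show "(\<lambda>m. \<Sum>x\<in>A. norm (ell1_apply (X n) x - ell1_apply (X m) x))
        \<longlonglongrightarrow> (\<Sum>x\<in>A. norm (ell1_apply (X n) x - L x))"
      by (intro tendsto_intros L)
    have "(\<Sum>x\<in>A. norm (ell1_apply (X n) x - ell1_apply (X m) x)) \<le> e" if "m \<ge> M" for m
      using sum_le_norm_ell1[OF \<open>finite A\<close>, of "X n - X m"] \<open>n \<ge> M\<close> that
        \<open>\<forall>m\<ge>M. \<forall>n\<ge>M. norm (X m - X n) < e\<close> by (force simp: diff)
    then show "\<forall>\<^sub>F m in sequentially. (\<Sum>x\<in>A. norm (ell1_apply (X n) x - ell1_apply (X m) x)) \<le> e"
      by (auto simp: eventually_sequentially)
  qed simp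
  have summ: "(\<lambda>x. ell1_apply (X n) x - L x) abs_summable_on UNIV"
    if "\<forall>m\<ge>M. \<forall>n\<ge>M. norm (X m - X n) < e" "n \<ge> M" for M n e
    unfolding abs_summable_iff_bdd_above
    by (rule bdd_aboveI2[where M = e]) (use fin that in auto)
  obtain M1 where "\<forall>m\<ge>M1. \<forall>n\<ge>M1. norm (X m - X n) < 1"
    using CauchyD[OF X, of 1] by auto
  from summ[OF this order_refl]
  have "(\<lambda>x. - 1 * (ell1_apply (X M1) x - L x) + ell1_apply (X M1) x) abs_summable_on UNIV"
    by (intro abs_summable_add abs_summable_cmult ell1_summable)
  then have "L abs_summable_on UNIV"
    by simp
  then have app: "ell1_apply (Abs_ell1 L) = L"
    by (simp add: ell1_apply.rep_eq Abs_ell1_inverse)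
  have "X \<longlonglongrightarrow> Abs_ell1 L"
  proof (rule LIMSEQ_I)
    fix e :: real
    assume "e > 0"
    then obtain M where M: "\<forall>m\<ge>M. \<forall>n\<ge>M. norm (X m - X n) < e / 2"
      using CauchyD[OF X, of "e / 2"] by auto
    have "norm (X n - Abs_ell1 L) \<le> e / 2" if "n \<ge> M" for n
    proof -
      have "norm (X n - Abs_ell1 L) = (\<Sum>\<^sub>\<infinity>x. norm (ell1_apply (X n - Abs_ell1 L) x))"
        by (simp add: norm_ell1.rep_eq ell1_apply.rep_eq)
      also have "\<dots> \<le> e / 2"
        by (rule infsum_le_finite_sums[OF ell1_summable])
          (use fin[OF _ M that] in \<open>simp add: diff app\<close>)
      finally show ?thesis .
    qed
    with \<open>e > 0\<close> show "\<exists>no. \<forall>n\<ge>no. norm (X n - Abs_ell1 L) < e"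
      by (intro exI[of _ M]) force
  qed
  then show "convergent X"
    by (auto simp: convergent_def)
qed

lemma infsum_fibers:
  fixes h :: "'b \<Rightarrow> complex" and \<pi> :: "'b \<Rightarrow> 'a"
  assumes h: "h abs_summable_on UNIV"
  shows "(\<lambda>u. \<Sum>\<^sub>\<infinity>x\<in>{x. \<pi> x = u}. h x) abs_summable_on UNIV"
    and "(\<Sum>\<^sub>\<infinity>u. \<Sum>\<^sub>\<infinity>x\<in>{x. \<pi> x = u}. h x) = (\<Sum>\<^sub>\<infinity>x. h x)"
    and "(\<Sum>\<^sub>\<infinity>u. norm (\<Sum>\<^sub>\<infinity>x\<in>{x. \<pi> x = u}. h x)) \<le> (\<Sum>\<^sub>\<infinity>x. norm (h x))"
proof -
  let ?S = "Sigma UNIV (\<lambda>u. {x. \<pi> x = u})"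
  have bij: "bij_betw snd ?S UNIV"
    by (rule bij_betwI[where g = "\<lambda>x. (\<pi> x, x)"]) auto
  have "(\<lambda>p. norm (h (snd p))) summable_on ?S"
    using summable_on_reindex_bij_betw[OF bij, of "\<lambda>x. norm (h x)"] h by simp
  then have S: "(\<lambda>p. h (snd p)) abs_summable_on ?S" .
  then have 1: "\<And>u. (\<lambda>x. h x) abs_summable_on {x. \<pi> x = u}"
    and 2: "(\<lambda>u. \<Sum>\<^sub>\<infinity>x\<in>{x. \<pi> x = u}. norm (h x)) abs_summable_on UNIV"
    using abs_summable_on_Sigma_iff[of "\<lambda>p. h (snd p)" UNIV "\<lambda>u. {x. \<pi> x = u}"] by auto
  have 3: "(\<lambda>u. \<Sum>\<^sub>\<infinity>x\<in>{x. \<pi> x = u}. norm (h x)) summable_on UNIV"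
    using 2 by (rule abs_summable_summable)
  show A: "(\<lambda>u. \<Sum>\<^sub>\<infinity>x\<in>{x. \<pi> x = u}. h x) abs_summable_on UNIV"
    by (rule abs_summable_on_comparison_test'[OF 3]) (rule norm_infsum_bound[OF 1])
  show "(\<Sum>\<^sub>\<infinity>u. \<Sum>\<^sub>\<infinity>x\<in>{x. \<pi> x = u}. h x) = (\<Sum>\<^sub>\<infinity>x. h x)"
    using infsum_Sigma_banach[OF abs_summable_summable[OF S]]
      infsum_reindex_bij_betw[OF bij, of h] by simp
  have "(\<Sum>\<^sub>\<infinity>u. norm (\<Sum>\<^sub>\<infinity>x\<in>{x. \<pi> x = u}. h x)) \<le> (\<Sum>\<^sub>\<infinity>u. \<Sum>\<^sub>\<infinity>x\<in>{x. \<pi> x = u}. norm (h x))"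
    by (rule infsum_mono[OF A 3]) (rule norm_infsum_bound[OF 1])
  also have "\<dots> = (\<Sum>\<^sub>\<infinity>x. norm (h x))"
    using infsum_Sigma_banach[of "\<lambda>p. norm (h (snd p))" UNIV "\<lambda>u. {x. \<pi> x = u}"] S
      infsum_reindex_bij_betw[OF bij, of "\<lambda>x. norm (h x)"] by simp
  finally show "(\<Sum>\<^sub>\<infinity>u. norm (\<Sum>\<^sub>\<infinity>x\<in>{x. \<pi> x = u}. h x)) \<le> (\<Sum>\<^sub>\<infinity>x. norm (h x))" .
qed

lemma abs_summable_tensor:
  fixes f :: "'a \<Rightarrow> complex" and g :: "'b \<Rightarrow> complex"
  assumes f: "f abs_summable_on UNIV" and g: "g abs_summable_on UNIV"
  shows "(\<lambda>p. f (fst p) * g (snd p)) abs_summable_on UNIV"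
    and "(\<Sum>\<^sub>\<infinity>p. norm (f (fst p) * g (snd p))) = (\<Sum>\<^sub>\<infinity>x. norm (f x)) * (\<Sum>\<^sub>\<infinity>y. norm (g y))"
proof -
  have "(\<lambda>p. f (fst p) * g (snd p)) abs_summable_on UNIV \<times> UNIV"
    unfolding abs_summable_on_Sigma_iff
    using f g by (auto simp: norm_mult infsum_cmult_right' abs_mult infsum_nonneg intro!: summable_on_cmult_right summable_on_cmult_left)
  then show S: "(\<lambda>p. f (fst p) * g (snd p)) abs_summable_on UNIV"
    by simp
  show "(\<Sum>\<^sub>\<infinity>p. norm (f (fst p) * g (snd p))) = (\<Sum>\<^sub>\<infinity>x. norm (f x)) * (\<Sum>\<^sub>\<infinity>y. norm (g y))"
    using infsum_Sigma_banach[of "\<lambda>p. norm (f (fst p) * g (snd p))" UNIV "\<lambda>_. UNIV"] S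
    by (simp add: norm_mult infsum_cmult_right' infsum_cmult_left')
qed

definition convolution :: "('a::semigroup_mult \<Rightarrow> complex) \<Rightarrow> ('a \<Rightarrow> complex) \<Rightarrow> 'a \<Rightarrow> complex"
  where "convolution f g u = (\<Sum>\<^sub>\<infinity>(s, t)\<in>{(s, t). s * t = u}. f s * g t)"

lemma convolution_fibers:
  "convolution f g u = (\<Sum>\<^sub>\<infinity>p\<in>{p. fst p * snd p = u}. f (fst p) * g (snd p))"
  unfolding convolution_def by (rule infsum_cong_neutral) auto

lemma convolution_abs_summable:
  assumes "f abs_summable_on UNIV" "g abs_summable_on UNIV"
  shows "convolution f g abs_summable_on UNIV"
  unfolding convolution_fibers by (rule infsum_fibers abs_summable_tensor assms)+

lemma convolution_pairing:
  fixes f g \<phi> :: "'a::semigroup_mult \<Rightarrow> complex"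
  assumes f: "f abs_summable_on UNIV" and g: "g abs_summable_on UNIV" and \<phi>: "\<And>x. norm (\<phi> x) \<le> 1"
  shows "(\<Sum>\<^sub>\<infinity>u. \<phi> u * convolution f g u) = (\<Sum>\<^sub>\<infinity>p. \<phi> (fst p * snd p) * (f (fst p) * g (snd p)))"
    and "(\<lambda>p. \<phi> (fst p * snd p) * (f (fst p) * g (snd p))) abs_summable_on UNIV"
proof -
  let ?h = "\<lambda>p. \<phi> (fst p * snd p) * (f (fst p) * g (snd p))"
  show S: "?h abs_summable_on UNIV"
    by (rule Infinite_Sum.abs_summable_on_comparison_test[OF abs_summable_tensor(1)[OF f g]])
      (simp add: norm_mult mult_left_le_one_le \<phi>)
  have "\<phi> u * convolution f g u = (\<Sum>\<^sub>\<infinity>p\<in>{p. fst p * snd p = u}. ?h p)" for u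
    unfolding convolution_fibers infsum_cmult_right'[symmetric]
    by (rule infsum_cong) simp
  then show "(\<Sum>\<^sub>\<infinity>u. \<phi> u * convolution f g u) = (\<Sum>\<^sub>\<infinity>p. ?h p)"
    using infsum_fibers(2)[OF S, of "\<lambda>p. fst p * snd p"] by simp
qed

lemma convolution_eq_pairing:
  assumes f: "f abs_summable_on UNIV" and g: "g abs_summable_on UNIV"
  shows "convolution f g w = (\<Sum>\<^sub>\<infinity>p. of_bool (fst p * snd p = w) * (f (fst p) * g (snd p)))"
  unfolding convolution_fibers by (rule infsum_cong_neutral) auto

lemma convolution_assoc:
  fixes f g h :: "'a::semigroup_mult \<Rightarrow> complex"
  assumes f: "f abs_summable_on UNIV" and g: "g abs_summable_on UNIV" and h: "h abs_summable_on UNIV"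
  shows "convolution (convolution f g) h w = convolution f (convolution g h) w"
proof -
  note fg = convolution_abs_summable[OF f g] and gh = convolution_abs_summable[OF g h]
  define T where "T = (\<lambda>(s, t, r). of_bool (s * t * r = w) * (f s * g t * h r))"
  have T: "T abs_summable_on UNIV"
  proof (rule Infinite_Sum.abs_summable_on_comparison_test)
    show "(\<lambda>p. f (fst p) * (\<lambda>q. g (fst q) * h (snd q)) (snd p)) abs_summable_on UNIV"
      by (intro abs_summable_tensor f g h)
  qed (auto simp: T_def norm_mult)
  have dirac: "norm (of_bool P :: complex) \<le> 1" for P
    by simp
  have P: "(\<lambda>p. of_bool (fst p * snd p = w) * (f' (fst p) * g' (snd p))) summable_on UNIV"
    if "f' abs_summable_on UNIV" "g' abs_summable_on UNIV" for f' g' :: "'a \<Rightarrow> complex"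
    using convolution_pairing(2)[OF that, of "\<lambda>u. of_bool (u = w)"]
    by (simp add: abs_summable_summable)
  have "convolution f (convolution g h) w
      = (\<Sum>\<^sub>\<infinity>p. of_bool (fst p * snd p = w) * (f (fst p) * convolution g h (snd p)))"
    by (rule convolution_eq_pairing[OF f gh])
  also have "\<dots> = (\<Sum>\<^sub>\<infinity>s. \<Sum>\<^sub>\<infinity>u. of_bool (s * u = w) * (f s * convolution g h u))"
    using infsum_Sigma_banach[of "\<lambda>p. of_bool (fst p * snd p = w) * (f (fst p) * convolution g h (snd p))"
        UNIV "\<lambda>_. UNIV"] P[OF f gh] by simp
  also have "\<dots> = (\<Sum>\<^sub>\<infinity>s. f s * (\<Sum>\<^sub>\<infinity>u. of_bool (s * u = w) * convolution g h u))"
    by (simp add: infsum_cmult_right'[symmetric] mult_ac)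
  also have "\<dots> = (\<Sum>\<^sub>\<infinity>s. f s * (\<Sum>\<^sub>\<infinity>p. of_bool (s * (fst p * snd p) = w) * (g (fst p) * h (snd p))))"
    by (subst convolution_pairing(1)[OF g h]) (simp_all add: dirac)
  also have "\<dots> = (\<Sum>\<^sub>\<infinity>s. \<Sum>\<^sub>\<infinity>p. T (s, p))"
    by (simp add: infsum_cmult_right'[symmetric] T_def case_prod_beta mult.assoc mult.left_commute)
  also have "\<dots> = (\<Sum>\<^sub>\<infinity>p. T p)"
    using infsum_Sigma_banach[of T UNIV "\<lambda>_. UNIV"] T by (simp add: abs_summable_summable)
  finally have right: "convolution f (convolution g h) w = (\<Sum>\<^sub>\<infinity>p. T p)" .

  let ?\<sigma> = "\<lambda>(r, s, t). (s, t, r)"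
  have bij: "bij_betw ?\<sigma> (UNIV :: ('a \<times> 'a \<times> 'a) set) UNIV"
    by (rule bij_betwI[where g = "\<lambda>(s, t, r). (r, s, t)"]) auto
  have T': "(\<lambda>p. T (?\<sigma> p)) summable_on UNIV"
    using T by (subst summable_on_reindex_bij_betw[OF bij]) (rule abs_summable_summable)
  have "convolution (convolution f g) h w
      = (\<Sum>\<^sub>\<infinity>p. of_bool (fst p * snd p = w) * (convolution f g (fst p) * h (snd p)))"
    by (rule convolution_eq_pairing[OF fg h])
  also have "\<dots> = (\<Sum>\<^sub>\<infinity>p. of_bool (snd p * fst p = w) * (convolution f g (snd p) * h (fst p)))"
    by (rule infsum_reindex_bij_witness[of _ prod.swap prod.swap]) auto
  also have "\<dots> = (\<Sum>\<^sub>\<infinity>r. \<Sum>\<^sub>\<infinity>u. of_bool (u * r = w) * (convolution f g u * h r))"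
  proof -
    have "(\<lambda>p. of_bool (snd p * fst p = w) * (convolution f g (snd p) * h (fst p))) summable_on UNIV"
      using P[OF fg h]
      by (subst summable_on_reindex_bij_witness[of _ prod.swap prod.swap UNIV
            "\<lambda>p. of_bool (fst p * snd p = w) * (convolution f g (fst p) * h (snd p))"]) auto
    then show ?thesis
      using infsum_Sigma_banach[of "\<lambda>p. of_bool (snd p * fst p = w) * (convolution f g (snd p) * h (fst p))"
          UNIV "\<lambda>_. UNIV"] by simp
  qed
  also have "\<dots> = (\<Sum>\<^sub>\<infinity>r. h r * (\<Sum>\<^sub>\<infinity>u. of_bool (u * r = w) * convolution f g u))"
    by (simp add: infsum_cmult_right'[symmetric] mult_ac)
  also have "\<dots> = (\<Sum>\<^sub>\<infinity>r. h r * (\<Sum>\<^sub>\<infinity>p. of_bool (fst p * snd p * r = w) * (f (fst p) * g (snd p))))"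
    by (subst convolution_pairing(1)[OF f g]) (simp_all add: dirac)
  also have "\<dots> = (\<Sum>\<^sub>\<infinity>r. \<Sum>\<^sub>\<infinity>p. T (?\<sigma> (r, p)))"
    by (simp add: infsum_cmult_right'[symmetric] T_def case_prod_beta mult_ac)
  also have "\<dots> = (\<Sum>\<^sub>\<infinity>p. T (?\<sigma> p))"
    using infsum_Sigma_banach[of "\<lambda>p. T (?\<sigma> p)" UNIV "\<lambda>_. UNIV"] T' by simp
  also have "\<dots> = (\<Sum>\<^sub>\<infinity>p. T p)"
    by (rule infsum_reindex_bij_betw[OF bij])
  finally show ?thesis
    using right by simp
qed

lemma convolution_linear:
  assumes "f abs_summable_on UNIV" "g abs_summable_on UNIV" "h abs_summable_on UNIV"
  shows "convolution (\<lambda>x. f x + g x) h u = convolution f h u + convolution g h u"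
    and "convolution h (\<lambda>x. f x + g x) u = convolution h f u + convolution h g u"
    and "convolution (\<lambda>x. c * f x) g u = c * convolution f g u"
    and "convolution f (\<lambda>x. c * g x) u = c * convolution f g u"
proof -
  have S: "(\<lambda>p. f (fst p) * g (snd p)) summable_on A"
    if "f abs_summable_on UNIV" "g abs_summable_on UNIV" for f g :: "'a \<Rightarrow> complex" and A
    using abs_summable_summable[OF abs_summable_tensor(1)[OF that]]
      summable_on_subset_banach[of _ UNIV A] by blast
  show "convolution (\<lambda>x. f x + g x) h u = convolution f h u + convolution g h u"
    "convolution h (\<lambda>x. f x + g x) u = convolution h f u + convolution h g u"
    unfolding convolution_fibers by (simp_all add: distrib_left distrib_right infsum_add S assms)
  show "convolution (\<lambda>x. c * f x) g u = c * convolution f g u"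
    "convolution f (\<lambda>x. c * g x) u = c * convolution f g u"
    unfolding convolution_fibers infsum_cmult_right'[symmetric] by (simp_all add: mult_ac)
qed

instantiation ell1 :: (semigroup_mult) complex_banach_algebra
begin

lift_definition times_ell1 :: "'a ell1 \<Rightarrow> 'a ell1 \<Rightarrow> 'a ell1" is convolution
  by (rule convolution_abs_summable)

instance
proof
  fix f g h :: "'a ell1" and r :: real and c :: complex
  show "f * g * h = f * (g * h)"
    by transfer (rule ext, rule convolution_assoc)
  show "(f + g) * h = f * h + g * h" "f * (g + h) = f * g + f * h"
    by (transfer, rule ext, simp add: convolution_linear)+
  show "(c *\<^sub>C f) * g = c *\<^sub>C (f * g)" "f * (c *\<^sub>C g) = c *\<^sub>C (f * g)"
    by (transfer, rule ext, simp add: convolution_linear)+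
  show "(r *\<^sub>R f) * g = r *\<^sub>R (f * g)" "f * (r *\<^sub>R g) = r *\<^sub>R (f * g)"
    unfolding scaleR_ell1_def by (transfer, rule ext, simp add: convolution_linear)+
  show "norm (f * g) \<le> norm f * norm g"
  proof transfer
    fix f g :: "'a \<Rightarrow> complex"
    assume fg: "f abs_summable_on UNIV" "g abs_summable_on UNIV"
    show "(\<Sum>\<^sub>\<infinity>x. norm (convolution f g x)) \<le> (\<Sum>\<^sub>\<infinity>x. norm (f x)) * (\<Sum>\<^sub>\<infinity>x. norm (g x))"
      unfolding convolution_fibers
      using infsum_fibers(3)[OF abs_summable_tensor(1)[OF fg], of "\<lambda>p. fst p * snd p"]
      by (simp add: abs_summable_tensor(2)[OF fg])
  qed
qed

end

lift_definition delta :: "'a \<Rightarrow> 'a ell1" is "\<lambda>s x. of_bool (x = s)"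
proof -
  fix s :: 'a
  have "(\<lambda>x. norm (of_bool (x = s) :: complex)) summable_on UNIV \<longleftrightarrow>
      (\<lambda>x. norm (of_bool (x = s) :: complex)) summable_on {s}"
    by (rule summable_on_cong_neutral) auto
  then show "(\<lambda>x. of_bool (x = s) :: complex) abs_summable_on UNIV"
    by simp
qed

lemma delta_mult: "delta s * delta t = delta (s * t)"
proof transfer
  fix s t :: 'a
  have "convolution (\<lambda>x. of_bool (x = s)) (\<lambda>x. of_bool (x = t)) u = of_bool (u = s * t)" for u
  proof -
    have "convolution (\<lambda>x. of_bool (x = s)) (\<lambda>x. of_bool (x = t)) u =
        (\<Sum>\<^sub>\<infinity>p\<in>{(s, t)}. of_bool (s * t = u) :: complex)"
      unfolding convolution_fibers by (rule infsum_cong_neutral) auto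
    then show ?thesis by auto
  qed
  then show "convolution (\<lambda>x. of_bool (x = s)) (\<lambda>x. of_bool (x = t)) = (\<lambda>x. of_bool (x = s * t))"
    by auto
qed

section \<open>Semigroups\<close>

definition left_cancellative :: "'a::semigroup_mult itself \<Rightarrow> bool"
  where "left_cancellative _ \<longleftrightarrow> (\<forall>a b c :: 'a. c * a = c * b \<longrightarrow> a = b)"

definition regular_semigroup :: "'a::semigroup_mult itself \<Rightarrow> bool"
  where "regular_semigroup _ \<longleftrightarrow> (\<forall>s :: 'a. \<exists>s'. s = s * s' * s \<and> s' = s' * s * s')"

definition is_group :: "'a::semigroup_mult itself \<Rightarrow> bool"
  where "is_group _ \<longleftrightarrow> (\<exists>e i. group ((*) :: 'a \<Rightarrow> 'a \<Rightarrow> 'a) e i)"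

end

theory Submission
  imports Defs
begin

text \<open>
  In a left cancellative semigroup every idempotent \<open>p\<close> is a left identity, because
  \<open>p (p x) = p x\<close>. Therefore \<open>\<delta>\<^sub>p\<close> is a left identity of \<open>\<ell>\<^sup>1(S)\<close>, and left identities survive
  the canonical embedding into the second dual with the first Arens product. Passing twice to the
  second dual, \<open>\<delta>\<^sub>p\<close> is a left identity of \<open>\<ell>\<^sup>1(S)\<^sup>*\<^sup>*\<^sup>*\<^sup>*\<close>.

  Hence an ultra central approximate identity \<open>(e\<^sub>i)\<close> satisfies
  \<open>e\<^sub>i = \<delta>\<^sub>p e\<^sub>i = e\<^sub>i \<delta>\<^sub>p\<close>, and the right-hand side converges to \<open>\<delta>\<^sub>p\<close>. The limit of the net
  thus names the idempotent \<open>p\<close>, so \<open>S\<close> has at most one idempotent. Regularity produces the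
  idempotents \<open>s s'\<close> and \<open>s' s\<close> for every \<open>s\<close>; as they coincide with one element \<open>p\<close>, this \<open>p\<close>
  is a two-sided identity and \<open>s'\<close> is an inverse of \<open>s\<close>.

  Conversely, if \<open>S\<close> is a group, then \<open>\<delta>\<^sub>1\<close> is a two-sided identity of \<open>\<ell>\<^sup>1(S)\<close>, which also
  survives both embeddings, and the constant net at this identity is ultra central.
\<close>

section \<open>Semigroups with at most one idempotent\<close>

lemma left_cancellative_idempotent_left_identity:
  fixes p :: "'s::semigroup_mult"
  assumes "left_cancellative TYPE('s)" "p * p = p"
  shows "p * x = x"
proof -
  have "p * (p * x) = p * x"
    by (simp add: assms(2) mult.assoc[symmetric])
  then show ?thesis
    using assms(1) unfolding left_cancellative_def by blast
qed

lemma regular_unique_idempotent_is_group: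
  assumes reg: "regular_semigroup TYPE('s::semigroup_mult)"
    and unique: "\<And>p q :: 's. p * p = p \<Longrightarrow> q * q = q \<Longrightarrow> p = q"
  shows "is_group TYPE('s)"
proof -
  from reg obtain i :: "'s \<Rightarrow> 's" where i: "\<And>s. s * i s * s = s" "\<And>s. i s * s * i s = i s"
    unfolding regular_semigroup_def by metis
  have left: "(i s * s) * (i s * s) = i s * s" for s
    by (metis i(2) mult.assoc)
  have right: "(s * i s) * (s * i s) = s * i s" for s
    by (metis i(1) mult.assoc)
  \<comment> \<open>A type is nonempty, and by uniqueness any element serves equally well here.\<close>
  define p where "p = i undefined * undefined"
  have p: "i s * s = p" "s * i s = p" for s
    unfolding p_def by (rule unique; rule left right)+
  have "group ((*) :: 's \<Rightarrow> 's \<Rightarrow> 's) p i"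
  proof
    show "p * s = s" for s
      using i(1)[of s] by (simp add: p)
    show "i s * s = p" for s
      by (rule p)
  qed
  then show ?thesis
    unfolding is_group_def by blast
qed

section \<open>Point masses in the semigroup algebra\<close>

lemma delta_left_identity:
  assumes "\<And>x. p * x = x"
  shows "delta p * f = f"
proof (rule ell1_eqI)
  fix u
  have "ell1_apply (delta p * f) u = convolution (\<lambda>x. of_bool (x = p)) (ell1_apply f) u"
    by transfer simp
  also have "\<dots> = (\<Sum>\<^sub>\<infinity>q\<in>{(p, u)}. ell1_apply f (snd q))"
    unfolding convolution_fibers by (rule infsum_cong_neutral) (auto simp: assms)
  finally show "ell1_apply (delta p * f) u = ell1_apply f u"
    by simp
qed

lemma delta_right_identity:
  assumes "\<And>x. x * p = x"
  shows "f * delta p = f"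
proof (rule ell1_eqI)
  fix u
  have "ell1_apply (f * delta p) u = convolution (ell1_apply f) (\<lambda>x. of_bool (x = p)) u"
    by transfer simp
  also have "\<dots> = (\<Sum>\<^sub>\<infinity>q\<in>{(u, p)}. ell1_apply f (fst q))"
    unfolding convolution_fibers by (rule infsum_cong_neutral) (auto simp: assms)
  finally show "ell1_apply (f * delta p) u = ell1_apply f u"
    by simp
qed

lemma delta_inject:
  fixes p q :: 'a
  assumes "delta p = delta q"
  shows "p = q"
proof -
  have apply_delta: "ell1_apply (delta s) x = of_bool (x = s)" for s x :: 'a
    by transfer (rule refl)
  have "of_bool (p = q) = (1 :: complex)"
    using apply_delta[of p p] apply_delta[of q p] unfolding assms by simp
  then show ?thesis
    by (simp split: if_splits)
qed

section \<open>The canonical embedding\<close>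

text \<open>
  Injectivity in general is the Hahn-Banach theorem. The two cases below avoid it, since
  coordinates separate the points of \<open>\<ell>\<^sup>1\<close> and evaluations at functionals separate the points of
  a second dual.
\<close>

lemma bidual_embed_ell1_inject:
  fixes f g :: "'a ell1"
  assumes "bidual_embed f = bidual_embed g"
  shows "f = g"
proof (rule ell1_eqI)
  fix x
  have "\<exists>\<phi>. \<forall>h :: 'a ell1. cdual_apply \<phi> h = ell1_apply h x"
  proof (rule cdual_ex[where K = 1])
    show "ell1_apply (h + k) x = ell1_apply h x + ell1_apply k x"
      "ell1_apply (c *\<^sub>C h) x = c * ell1_apply h x" for h k :: "'a ell1" and c
      by (transfer, simp)+
    show "cmod (ell1_apply h x) \<le> norm h * 1" for h :: "'a ell1"
      using sum_le_norm_ell1[of "{x}" h] by simp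
  qed
  then obtain \<phi> where \<phi>: "\<And>h :: 'a ell1. cdual_apply \<phi> h = ell1_apply h x"
    by blast
  have "ell1_apply f x = bidual_apply (bidual_embed f) \<phi>"
    by (simp add: \<phi>)
  then show "ell1_apply f x = ell1_apply g x"
    by (simp add: assms \<phi>)
qed

lemma bidual_embed_bidual_inject:
  fixes F G :: "'a::complex_normed_vector bidual"
  assumes "bidual_embed F = bidual_embed G"
  shows "F = G"
proof (rule bidual_eqI)
  fix f
  have "\<exists>\<phi>. \<forall>H :: 'a bidual. cdual_apply \<phi> H = bidual_apply H f"
    by (rule cdual_ex[where K = "norm f"]) (simp_all add: norm_bidual_apply)
  then obtain \<phi> where \<phi>: "\<And>H :: 'a bidual. cdual_apply \<phi> H = bidual_apply H f"
    by blast
  have "bidual_apply F f = bidual_apply (bidual_embed F) \<phi>"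
    by (simp add: \<phi>)
  then show "bidual_apply F f = bidual_apply G f"
    by (simp add: assms \<phi>)
qed

text \<open>
  Unfolding the first Arens product, \<open>(a F)(f) = F (f \<cdot> a)\<close> and \<open>(F a)(f) = F (a \<cdot> f)\<close>, where
  \<open>(f \<cdot> a)(b) = f (a b)\<close> and \<open>(a \<cdot> f)(b) = f (b a)\<close>; an identity on either side makes the
  corresponding action on functionals trivial.
\<close>

lemma bidual_embed_left_identity:
  fixes u :: "'a::complex_normed_algebra"
  assumes "\<And>a. u * a = a"
  shows "bidual_embed u * F = F"
proof (rule bidual_eqI)
  fix f
  have "cdual_act f u = f"
    by (rule cdual_eqI) (simp add: assms)
  then show "bidual_apply (bidual_embed u * F) f = bidual_apply F f"
    by (simp add: times_bidual_def)
qed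

lemma bidual_embed_right_identity:
  fixes u :: "'a::complex_normed_algebra"
  assumes "\<And>a. a * u = a"
  shows "F * bidual_embed u = F"
proof (rule bidual_eqI)
  fix f
  have "bidual_act (bidual_embed u) f = f"
    by (rule cdual_eqI) (simp add: assms)
  then show "bidual_apply (F * bidual_embed u) f = bidual_apply F f"
    by (simp add: times_bidual_def)
qed

section \<open>Ultra central approximate identities and one-sided identities\<close>

lemma tails_neq_bot:
  assumes "directed_set I le"
  shows "tails I le \<noteq> bot"
proof -
  have "\<forall>i\<in>I. le i i"
    using assms by (simp add: directed_set_def)
  then show ?thesis
    unfolding trivial_limit_def eventually_tails[OF assms] by blast
qed

text \<open>
  Centrality moves a left identity \<open>u\<close> to the other side of the net, \<open>e\<^sub>i = u e\<^sub>i = e\<^sub>i u\<close>, so the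
  net itself converges to the image of \<open>u\<close>, and limits are unique.
\<close>

lemma ultra_central_left_identity_unique:
  fixes u v :: "'b::complex_banach_algebra"
  assumes "has_ultra_central_approximate_identity TYPE('b)"
    and u: "\<And>b. u * b = b" and v: "\<And>b. v * b = b"
  shows "bidual_embed u = bidual_embed v"
proof -
  from assms(1) obtain I :: "('b set \<times> nat) set" and le and e :: "'b set \<times> nat \<Rightarrow> 'b bidual"
    where "ultra_central_approximate_identity I le e"
    unfolding has_ultra_central_approximate_identity_def by (elim exE)
  then have dir: "directed_set I le"
    and comm: "\<And>b i. i \<in> I \<Longrightarrow> bidual_embed b * e i = e i * bidual_embed b"
    and lim: "\<And>b. ((\<lambda>i. e i * bidual_embed b) \<longlongrightarrow> bidual_embed b) (tails I le)"
    unfolding ultra_central_approximate_identity_def by simp_all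
  have limit: "(e \<longlongrightarrow> bidual_embed w) (tails I le)" if w: "\<And>b. w * b = b" for w
  proof (rule Lim_transform_eventually[OF lim[of w]])
    have "e i * bidual_embed w = e i" if "i \<in> I" for i
      unfolding comm[OF that, symmetric] by (rule bidual_embed_left_identity[OF w])
    moreover have "I \<noteq> {}"
      using dir by (simp add: directed_set_def)
    ultimately show "\<forall>\<^sub>F i in tails I le. e i * bidual_embed w = e i"
      unfolding eventually_tails[OF dir] by blast
  qed
  show ?thesis
    by (rule tendsto_unique[OF tails_neq_bot[OF dir] limit[OF u] limit[OF v]])
qed

lemma unital_has_ultra_central_approximate_identity:
  fixes u :: "'b::complex_banach_algebra"
  assumes "\<And>b. u * b = b" "\<And>b. b * u = b"
  shows "has_ultra_central_approximate_identity TYPE('b)"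
proof (rule has_ultra_central_approximate_identityI)
  show "ultra_central_approximate_identity {()} (\<lambda>_ _. True) (\<lambda>_. bidual_embed u)"
    unfolding ultra_central_approximate_identity_def
      bidual_embed_left_identity[OF assms(1)] bidual_embed_right_identity[OF assms(2)]
    by (simp add: directed_set_def)
qed

section \<open>Characterization of groups\<close>

theorem theorem5p5:
  assumes "left_cancellative TYPE('s::semigroup_mult)"
    and "regular_semigroup TYPE('s)"
  shows "has_ultra_central_approximate_identity TYPE('s ell1 bidual) \<longleftrightarrow> is_group TYPE('s)"
proof
  assume uca: "has_ultra_central_approximate_identity TYPE('s ell1 bidual)"
  show "is_group TYPE('s)"
  proof (rule regular_unique_idempotent_is_group[OF assms(2)])
    fix p q :: 's
    assume idem: "p * p = p" "q * q = q"
    have left: "bidual_embed (delta r) * F = F" if "r * r = r" for r :: 's and F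
      by (rule bidual_embed_left_identity[OF delta_left_identity[OF
            left_cancellative_idempotent_left_identity[OF assms(1) that]]])
    have "bidual_embed (bidual_embed (delta p)) = bidual_embed (bidual_embed (delta q))"
      by (rule ultra_central_left_identity_unique[OF uca left[OF idem(1)] left[OF idem(2)]])
    then show "p = q"
      by (rule delta_inject[OF bidual_embed_ell1_inject[OF bidual_embed_bidual_inject]])
  qed
next
  assume "is_group TYPE('s)"
  then obtain e i where "group ((*) :: 's \<Rightarrow> 's \<Rightarrow> 's) e i"
    unfolding is_group_def by blast
  then interpret G: group "(*) :: 's \<Rightarrow> 's \<Rightarrow> 's" e i .
  show "has_ultra_central_approximate_identity TYPE('s ell1 bidual)"
    by (rule unital_has_ultra_central_approximate_identity
          [OF bidual_embed_left_identity[OF delta_left_identity[OF G.left_neutral]]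
            bidual_embed_right_identity[OF delta_right_identity[OF G.right_neutral]]])
qed

end
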